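(* Let $u\colon\mathbb{R}^3\to\mathbb{O}$ have octonion Fourier transform $U$. Let $f_0\in\mathbb{R}$ and, for $i=1,2,3$, let $u^{\sin,i}(\mathbf{x})=u(\mathbf{x})\cdot\sin(2\pi f_0x_i)$ and let $U^{\sin,i}$ be the octonion Fourier transform of $u^{\sin,i}$. Then for all $(f_1,f_2,f_3)\in\mathbb{R}^3$ $$\begin{aligned} U^{\sin,1}(f_1,f_2,f_3)&=\big(U(f_1+f_0,-f_2,-f_3)-U(f_1-f_0,-f_2,-f_3)\big)\cdot\frac{\mathbf{e}_1}{2}, \\ U^{\sin,2}(f_1,f_2,f_3)&=\big(U(f_1,f_2+f_0,-f_3)-U(f_1,f_2-f_0,-f_3)\big)\cdot\frac{\mathbf{e}_2}{2}, \\ U^{\sin,3}(f_1,f_2,f_3)&=\big(U(f_1,f_2,f_3+f_0)-U(f_1,f_2,f_3-f_0)\big)\cdot\frac{\mathbf{e}_4}{2}.\end{aligned}$$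
   Context: $\mathbb{O}$ denotes the real algebra of octonions with basis $1,\mathbf{e}_1,\dots,\mathbf{e}_7$: an octonion is a pair $(q_0,q_1)$ of quaternions (quaternion units $\mathbf{e}_1,\mathbf{e}_2,\mathbf{e}_3$ with $\mathbf{e}_1\mathbf{e}_2=\mathbf{e}_3$), with product $(q_0,q_1)\cdot(p_0,p_1)=(q_0p_0-p_1^*q_1,\;p_1q_0+q_1p_0^* )$, where $^*$ is quaternion conjugation, and $\mathbf{e}_4=(0,1)$, $\mathbf{e}_5=(0,\mathbf{e}_1)$, $\mathbf{e}_6=(0,\mathbf{e}_2)$, $\mathbf{e}_7=(0,\mathbf{e}_3)$. The product is neither commutative nor associative; products without brackets are evaluated from left to right, i.e. $abcd=((ab)c)d$. For an imaginary unit $\mathbf{e}_k$ and $\alpha\in\mathbb{R}$, $e^{\mathbf{e}_k\alpha}=\cos\alpha+\mathbf{e}_k\sin\alpha$. Integrals of octonion-valued functions are taken componentwise. The octonion Fourier transform (OFT) of a Lebesgue integrable $u\colon\mathbb{R}^3\to\mathbb{O}$ is $$U(\mathbf{f})=\int_{\mathbb{R}^3}u(\mathbf{x})\,e^{-\mathbf{e}_1 2\pi f_1x_1}\,e^{-\mathbf{e}_2 2\pi f_2x_2}\,e^{-\mathbf{e}_4 2\pi f_3x_3}\,d\mathbf{x},\qquad \mathbf{f}=(f_1,f_2,f_3)\in\mathbb{R}^3,$$ with multiplication from left to right. Standing assumption: $u$ is Lebesgue integrable, so that its OFT is well defined. *)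

theory Defs
  imports "HOL-Analysis.Analysis"
begin

datatype quat = Quat (q_re: real) (q_im1: real) (q_im2: real) (q_im3: real)

instantiation quat :: real_algebra_1
begin

definition "0 = Quat 0 0 0 0"

definition "1 = Quat 1 0 0 0"

definition "p + q = Quat (q_re p + q_re q) (q_im1 p + q_im1 q) (q_im2 p + q_im2 q) (q_im3 p + q_im3 q)"

definition "p - q = Quat (q_re p - q_re q) (q_im1 p - q_im1 q) (q_im2 p - q_im2 q) (q_im3 p - q_im3 q)"

definition "- q = Quat (- q_re q) (- q_im1 q) (- q_im2 q) (- q_im3 q)"

definition "scaleR r q = Quat (r * q_re q) (r * q_im1 q) (r * q_im2 q) (r * q_im3 q)"

text \<open>Hamilton product, oriented so that the first unit times the second is the third.\<close>

definition "p * q = Quat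
  (q_re p * q_re q - q_im1 p * q_im1 q - q_im2 p * q_im2 q - q_im3 p * q_im3 q)
  (q_re p * q_im1 q + q_im1 p * q_re q + q_im2 p * q_im3 q - q_im3 p * q_im2 q)
  (q_re p * q_im2 q - q_im1 p * q_im3 q + q_im2 p * q_re q + q_im3 p * q_im1 q)
  (q_re p * q_im3 q + q_im1 p * q_im2 q - q_im2 p * q_im1 q + q_im3 p * q_re q)"

instance
  by standard
    (simp_all add: zero_quat_def one_quat_def plus_quat_def minus_quat_def uminus_quat_def
      scaleR_quat_def times_quat_def algebra_simps)

end

definition q_cnj :: "quat \<Rightarrow> quat" where
  "q_cnj q = Quat (q_re q) (- q_im1 q) (- q_im2 q) (- q_im3 q)"

datatype octonion = Oct (oct_fst: quat) (oct_snd: quat)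

text \<open>The product is not associative, so octonions are an instance of
  \<^class>\<open>real_vector\<close> and of the purely syntactic classes \<^class>\<open>times\<close> and \<^class>\<open>one\<close>
  only. As \<open>*\<close> is left-associative, unbracketed products are evaluated from left to right.\<close>

instantiation octonion :: "{real_vector, times, one}"
begin

definition "0 = Oct 0 0"

definition "1 = Oct 1 0"

definition "a + b = Oct (oct_fst a + oct_fst b) (oct_snd a + oct_snd b)"

definition "a - b = Oct (oct_fst a - oct_fst b) (oct_snd a - oct_snd b)"

definition "- a = Oct (- oct_fst a) (- oct_snd a)"

definition "scaleR r a = Oct (r *\<^sub>R oct_fst a) (r *\<^sub>R oct_snd a)"

definition "a * b = Oct
  (oct_fst a * oct_fst b - q_cnj (oct_snd b) * oct_snd a)
  (oct_snd b * oct_fst a + oct_snd a * q_cnj (oct_fst b))"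

instance
  by standard
    (simp_all add: zero_octonion_def plus_octonion_def minus_octonion_def uminus_octonion_def
      scaleR_octonion_def algebra_simps)

end

definition oct_e1 :: octonion where "oct_e1 = Oct (Quat 0 1 0 0) 0"

definition oct_e2 :: octonion where "oct_e2 = Oct (Quat 0 0 1 0) 0"

definition oct_e4 :: octonion where "oct_e4 = Oct 0 1"

text \<open>Only meant for imaginary units \<open>e\<close>, where it is the exponential of \<open>e\<alpha>\<close>.\<close>

definition oct_cis :: "octonion \<Rightarrow> real \<Rightarrow> octonion" where
  "oct_cis e \<alpha> = cos \<alpha> *\<^sub>R 1 + sin \<alpha> *\<^sub>R e"

definition quat_integrable :: "'a measure \<Rightarrow> ('a \<Rightarrow> quat) \<Rightarrow> bool" where
  "quat_integrable M f \<longleftrightarrow>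
     integrable M (\<lambda>x. q_re (f x)) \<and> integrable M (\<lambda>x. q_im1 (f x)) \<and>
     integrable M (\<lambda>x. q_im2 (f x)) \<and> integrable M (\<lambda>x. q_im3 (f x))"

definition oct_integrable :: "'a measure \<Rightarrow> ('a \<Rightarrow> octonion) \<Rightarrow> bool" where
  "oct_integrable M f \<longleftrightarrow>
     quat_integrable M (\<lambda>x. oct_fst (f x)) \<and> quat_integrable M (\<lambda>x. oct_snd (f x))"

definition quat_integral :: "'a measure \<Rightarrow> ('a \<Rightarrow> quat) \<Rightarrow> quat" where
  "quat_integral M f = Quat
     (LINT x|M. q_re (f x)) (LINT x|M. q_im1 (f x)) (LINT x|M. q_im2 (f x)) (LINT x|M. q_im3 (f x))"

definition oct_integral :: "'a measure \<Rightarrow> ('a \<Rightarrow> octonion) \<Rightarrow> octonion" where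
  "oct_integral M f = Oct
     (quat_integral M (\<lambda>x. oct_fst (f x))) (quat_integral M (\<lambda>x. oct_snd (f x)))"

definition oct_fourier :: "(real^3 \<Rightarrow> octonion) \<Rightarrow> real^3 \<Rightarrow> octonion" where
  "oct_fourier u f = oct_integral lebesgue (\<lambda>x.
     u x * oct_cis oct_e1 (- (2 * pi * f $ 1 * x $ 1))
         * oct_cis oct_e2 (- (2 * pi * f $ 2 * x $ 2))
         * oct_cis oct_e4 (- (2 * pi * f $ 3 * x $ 3)))"

end

theory Submission
  imports Defs
begin

text \<open>
  Fix an imaginary unit \<open>e\<close>. In the complex plane spanned by \<open>1\<close> and \<open>e\<close>, the difference of the
  exponentials of \<open>- e (\<alpha> + \<delta>)\<close> and \<open>- e (\<alpha> - \<delta>)\<close> is \<open>- 2 sin \<delta>\<close> times the exponential of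
  \<open>- e \<alpha>\<close> times \<open>e\<close>. Hence shifting the frequency of one kernel factor in both directions and
  subtracting produces the factor \<open>sin \<delta>\<close>, at the price of a stray right multiplication by \<open>e\<close>
  in the middle of the kernel (\<open>oct_cis_frequency_shift\<close>).

  This stray \<open>e\<close> is carried to the right end of the kernel, where the factor \<open>e / 2\<close> cancels it.
  Octonions are not associative, but they are right alternative, \<open>(x a) a = x (a a)\<close>; polarised,
  this says that right multiplications by anticommuting elements anticommute. So \<open>e\<close> passes a
  later kernel factor, built from an orthogonal unit, by reversing the sign of its phase
  (\<open>oct_cis_commute\<close>). That is why the frequencies after the modulated one appear with the
  opposite sign, whereas the earlier ones are unaffected.

  The resulting identities hold for the integrands pointwise. They are integrated by linearity of
  the componentwise integral, for which the kernel times \<open>u\<close> has to be integrable: its factors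
  are bounded and measurable.
\<close>

section \<open>Right alternativity of the octonions\<close>

lemma quat_eqI:
  assumes "q_re p = q_re q" "q_im1 p = q_im1 q" "q_im2 p = q_im2 q" "q_im3 p = q_im3 q"
  shows "p = q"
  using assms by (simp add: quat.expand)

lemma oct_eqI:
  assumes "oct_fst x = oct_fst y" "oct_snd x = oct_snd y"
  shows "x = y"
  using assms by (simp add: octonion.expand)

lemmas quat_components = zero_quat_def one_quat_def plus_quat_def minus_quat_def
  uminus_quat_def scaleR_quat_def times_quat_def q_cnj_def

lemmas oct_components = zero_octonion_def one_octonion_def plus_octonion_def
  minus_octonion_def uminus_octonion_def scaleR_octonion_def times_octonion_def

lemma oct_distrib:
  fixes x y z :: octonion
  shows oct_distrib_right: "(x + y) * z = x * z + y * z"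
    and oct_distrib_left: "x * (y + z) = x * y + x * z"
    and oct_diff_distrib_right: "(x - y) * z = x * z - y * z"
    and oct_minus_left: "(- x) * y = - (x * y)"
    and oct_minus_right: "x * (- y) = - (x * y)"
    and oct_zero_right: "x * 0 = 0"
    and oct_scaleR_left: "(r *\<^sub>R x) * y = r *\<^sub>R (x * y)"
    and oct_scaleR_right: "x * (r *\<^sub>R y) = r *\<^sub>R (x * y)"
  by (auto intro!: oct_eqI quat_eqI simp: oct_components quat_components algebra_simps)

lemma oct_mult_1_right: "x * 1 = (x :: octonion)"
  by (intro oct_eqI quat_eqI) (simp_all add: oct_components quat_components)

lemma oct_right_alternative: "(x * a) * a = x * (a * a)" for x a :: octonion
  by (intro oct_eqI quat_eqI; simp add: oct_components quat_components; algebra)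

text \<open>Polarisation: expand right alternativity for \<open>a + b\<close> and cancel the pure squares.\<close>

lemma oct_right_alternative_polarised:
  fixes x a b :: octonion
  shows "(x * a) * b + (x * b) * a = x * (a * b + b * a)"
proof -
  have "(x * (a + b)) * (a + b) = x * ((a + b) * (a + b))"
    by (rule oct_right_alternative)
  then show ?thesis
    by (simp add: oct_distrib oct_right_alternative algebra_simps)
qed

lemma oct_right_mult_anticommute:
  fixes x a b :: octonion
  assumes "a * b = - (b * a)"
  shows "(x * a) * b = - ((x * b) * a)"
  using oct_right_alternative_polarised[of x a b] assms
  by (simp add: oct_zero_right eq_neg_iff_add_eq_0)

lemma oct_right_mult_imaginary_unit:
  fixes x e :: octonion
  assumes "e * e = - 1"
  shows "(x * e) * e = - x"
  by (simp add: oct_right_alternative assms oct_minus_right oct_mult_1_right)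

lemma oct_units_square: "oct_e1 * oct_e1 = - 1" "oct_e2 * oct_e2 = - 1" "oct_e4 * oct_e4 = - 1"
  by (intro oct_eqI quat_eqI;
      simp add: oct_e1_def oct_e2_def oct_e4_def oct_components quat_components)+

lemma oct_units_anticommute:
  "oct_e1 * oct_e2 = - (oct_e2 * oct_e1)"
  "oct_e1 * oct_e4 = - (oct_e4 * oct_e1)"
  "oct_e2 * oct_e4 = - (oct_e4 * oct_e2)"
  by (intro oct_eqI quat_eqI;
      simp add: oct_e1_def oct_e2_def oct_e4_def oct_components quat_components)+

section \<open>Exponential factors\<close>

lemma oct_mult_cis: "x * oct_cis e \<alpha> = cos \<alpha> *\<^sub>R x + sin \<alpha> *\<^sub>R (x * e)"
  by (simp add: oct_cis_def oct_distrib oct_mult_1_right)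

lemma oct_cis_frequency_shift:
  assumes "e * e = - 1"
  shows "x * oct_cis e (- (\<alpha> + \<delta>)) - x * oct_cis e (- (\<alpha> - \<delta>))
       = (- (2 * sin \<delta>)) *\<^sub>R ((x * oct_cis e (- \<alpha>)) * e)"
proof -
  have "x * oct_cis e (- (\<alpha> + \<delta>)) - x * oct_cis e (- (\<alpha> - \<delta>))
      = (cos (\<alpha> + \<delta>) - cos (\<alpha> - \<delta>)) *\<^sub>R x - (sin (\<alpha> + \<delta>) - sin (\<alpha> - \<delta>)) *\<^sub>R (x * e)"
    unfolding oct_mult_cis cos_minus sin_minus by (simp add: algebra_simps)
  also have "\<dots> = (- (2 * sin \<alpha> * sin \<delta>)) *\<^sub>R x - (2 * cos \<alpha> * sin \<delta>) *\<^sub>R (x * e)"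
    by (simp add: cos_add cos_diff sin_add sin_diff mult.assoc)
  also have "\<dots> = (- (2 * sin \<delta>)) *\<^sub>R ((x * oct_cis e (- \<alpha>)) * e)"
    by (simp add: oct_mult_cis oct_distrib oct_right_mult_imaginary_unit[OF assms]
        algebra_simps)
  finally show ?thesis .
qed

text \<open>Only the sine part of the factor anticommutes with \<open>e\<close>, so moving \<open>e\<close> past the factor
  conjugates it.\<close>

lemma oct_cis_commute:
  assumes "e * g = - (g * e)"
  shows "(x * e) * oct_cis g \<beta> = (x * oct_cis g (- \<beta>)) * e"
  by (simp add: oct_mult_cis oct_distrib oct_right_mult_anticommute[OF assms])

text \<open>What remains of the stray unit once it has reached the end of the kernel.\<close>

lemma oct_cancel_unit:
  fixes x e :: octonion
  assumes "e * e = - 1"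
  shows "((- (2 * s)) *\<^sub>R (x * e)) * (e /\<^sub>R 2) = s *\<^sub>R x"
  by (simp add: oct_distrib oct_right_mult_imaginary_unit[OF assms])

text \<open>The three pointwise identities differ in the number of later factors that the stray unit has
  to pass. The factors before \<open>e\<close> are absorbed into \<open>x\<close>, since products associate to the left.\<close>

lemma oct_modulation_last:
  assumes "e * e = - 1"
  shows "(x * oct_cis e (- (\<alpha> + \<delta>)) - x * oct_cis e (- (\<alpha> - \<delta>))) * (e /\<^sub>R 2)
    = sin \<delta> *\<^sub>R (x * oct_cis e (- \<alpha>))"
  by (simp only: oct_cis_frequency_shift[OF assms] oct_cancel_unit[OF assms])

lemma oct_modulation_one_later_factor:
  assumes "e * e = - 1" "e * g = - (g * e)"
  shows "(x * oct_cis e (- (\<alpha> + \<delta>)) * oct_cis g \<beta> - x * oct_cis e (- (\<alpha> - \<delta>)) * oct_cis g \<beta>)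
      * (e /\<^sub>R 2)
    = sin \<delta> *\<^sub>R (x * oct_cis e (- \<alpha>) * oct_cis g (- \<beta>))"
  by (simp only: oct_diff_distrib_right[symmetric] oct_cis_frequency_shift[OF assms(1)]
      oct_scaleR_left[where y = "oct_cis _ _"] oct_cis_commute[OF assms(2)]
      oct_cancel_unit[OF assms(1)])

lemma oct_modulation_two_later_factors:
  assumes "e * e = - 1" "e * g = - (g * e)" "e * h = - (h * e)"
  shows "(x * oct_cis e (- (\<alpha> + \<delta>)) * oct_cis g \<beta> * oct_cis h \<gamma>
        - x * oct_cis e (- (\<alpha> - \<delta>)) * oct_cis g \<beta> * oct_cis h \<gamma>) * (e /\<^sub>R 2)
    = sin \<delta> *\<^sub>R (x * oct_cis e (- \<alpha>) * oct_cis g (- \<beta>) * oct_cis h (- \<gamma>))"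
  by (simp only: oct_diff_distrib_right[symmetric] oct_cis_frequency_shift[OF assms(1)]
      oct_scaleR_left[where y = "oct_cis _ _"] oct_cis_commute[OF assms(2)]
      oct_cis_commute[OF assms(3)] oct_cancel_unit[OF assms(1)])

section \<open>Linearity of the componentwise integral\<close>

lemma oct_integrable_iff:
  "oct_integrable M f \<longleftrightarrow>
     integrable M (\<lambda>x. q_re (oct_fst (f x))) \<and> integrable M (\<lambda>x. q_im1 (oct_fst (f x))) \<and>
     integrable M (\<lambda>x. q_im2 (oct_fst (f x))) \<and> integrable M (\<lambda>x. q_im3 (oct_fst (f x))) \<and>
     integrable M (\<lambda>x. q_re (oct_snd (f x))) \<and> integrable M (\<lambda>x. q_im1 (oct_snd (f x))) \<and>
     integrable M (\<lambda>x. q_im2 (oct_snd (f x))) \<and> integrable M (\<lambda>x. q_im3 (oct_snd (f x)))"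
  by (simp add: oct_integrable_def quat_integrable_def)

lemma oct_integrable_add:
  assumes "oct_integrable M f" "oct_integrable M g"
  shows "oct_integrable M (\<lambda>x. f x + g x)"
  using assms by (simp add: oct_integrable_iff oct_components quat_components)

lemma oct_integrable_diff:
  assumes "oct_integrable M f" "oct_integrable M g"
  shows "oct_integrable M (\<lambda>x. f x - g x)"
  using assms by (simp add: oct_integrable_iff oct_components quat_components)

lemma oct_integrable_mult_const:
  assumes "oct_integrable M f"
  shows "oct_integrable M (\<lambda>x. f x * a)"
  using assms by (simp add: oct_integrable_iff oct_components quat_components)

lemma integrable_bounded_mult:
  fixes g h :: "'a \<Rightarrow> real"
  assumes "integrable M h" "g \<in> borel_measurable M" "\<And>x. \<bar>g x\<bar> \<le> 1"
  shows "integrable M (\<lambda>x. g x * h x)"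
proof (rule Bochner_Integration.integrable_bound[OF assms(1)])
  show "(\<lambda>x. g x * h x) \<in> borel_measurable M"
    using assms(1,2) by measurable
  show "AE x in M. norm (g x * h x) \<le> norm (h x)"
    using assms(3) by (simp add: abs_mult mult_left_le_one_le)
qed

lemma oct_integrable_bounded_scaleR:
  assumes "oct_integrable M f" "g \<in> borel_measurable M" "\<And>x. \<bar>g x\<bar> \<le> 1"
  shows "oct_integrable M (\<lambda>x. g x *\<^sub>R f x)"
  using assms
  by (simp add: oct_integrable_iff oct_components quat_components integrable_bounded_mult)

lemma oct_integrable_mult_cis:
  assumes "oct_integrable M f" "\<alpha> \<in> borel_measurable M"
  shows "oct_integrable M (\<lambda>x. f x * oct_cis e (\<alpha> x))"
  unfolding oct_mult_cis using assms
  by (intro oct_integrable_add oct_integrable_bounded_scaleR oct_integrable_mult_const) auto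

lemma oct_integral_diff:
  assumes "oct_integrable M f" "oct_integrable M g"
  shows "oct_integral M (\<lambda>x. f x - g x) = oct_integral M f - oct_integral M g"
  using assms
  by (simp add: oct_integrable_iff oct_integral_def quat_integral_def oct_components quat_components)

lemma oct_integral_mult_const:
  assumes "oct_integrable M f"
  shows "oct_integral M (\<lambda>x. f x * a) = oct_integral M f * a"
  using assms
  by (simp add: oct_integrable_iff oct_integral_def quat_integral_def oct_components quat_components)

section \<open>The modulation theorem\<close>

lemma vec_nth_borel_measurable_lebesgue [measurable]:
  "(\<lambda>x :: real^'n. x $ i) \<in> borel_measurable lebesgue"
  by (intro measurable_completion) simp

lemma oct_integrable_fourier_kernel:
  fixes u :: "real^3 \<Rightarrow> octonion"
  assumes "oct_integrable lebesgue u"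
  shows "oct_integrable lebesgue (\<lambda>x.
     u x * oct_cis oct_e1 (- (2 * pi * f $ 1 * x $ 1))
         * oct_cis oct_e2 (- (2 * pi * f $ 2 * x $ 2))
         * oct_cis oct_e4 (- (2 * pi * f $ 3 * x $ 3)))"
  using assms by (intro oct_integrable_mult_cis) measurable

lemma oct_fourier_diff_mult:
  assumes "oct_integrable lebesgue u"
  shows "(oct_fourier u f - oct_fourier u g) * a = oct_integral lebesgue (\<lambda>x.
     (u x * oct_cis oct_e1 (- (2 * pi * f $ 1 * x $ 1))
          * oct_cis oct_e2 (- (2 * pi * f $ 2 * x $ 2))
          * oct_cis oct_e4 (- (2 * pi * f $ 3 * x $ 3))
    - u x * oct_cis oct_e1 (- (2 * pi * g $ 1 * x $ 1))
          * oct_cis oct_e2 (- (2 * pi * g $ 2 * x $ 2))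
          * oct_cis oct_e4 (- (2 * pi * g $ 3 * x $ 3))) * a)"
  unfolding oct_fourier_def
  by (simp add: oct_integral_mult_const oct_integral_diff oct_integrable_diff
      oct_integrable_fourier_kernel assms)

theorem theorem11:
  fixes u :: "real^3 \<Rightarrow> octonion" and f\<^sub>0 :: real
  assumes "oct_integrable lebesgue u"
  shows "\<forall>f\<^sub>1 f\<^sub>2 f\<^sub>3.
    oct_fourier (\<lambda>x. sin (2 * pi * f\<^sub>0 * x $ 1) *\<^sub>R u x) (vector [f\<^sub>1, f\<^sub>2, f\<^sub>3])
      = (oct_fourier u (vector [f\<^sub>1 + f\<^sub>0, - f\<^sub>2, - f\<^sub>3])
         - oct_fourier u (vector [f\<^sub>1 - f\<^sub>0, - f\<^sub>2, - f\<^sub>3])) * (oct_e1 /\<^sub>R 2) \<and>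
    oct_fourier (\<lambda>x. sin (2 * pi * f\<^sub>0 * x $ 2) *\<^sub>R u x) (vector [f\<^sub>1, f\<^sub>2, f\<^sub>3])
      = (oct_fourier u (vector [f\<^sub>1, f\<^sub>2 + f\<^sub>0, - f\<^sub>3])
         - oct_fourier u (vector [f\<^sub>1, f\<^sub>2 - f\<^sub>0, - f\<^sub>3])) * (oct_e2 /\<^sub>R 2) \<and>
    oct_fourier (\<lambda>x. sin (2 * pi * f\<^sub>0 * x $ 3) *\<^sub>R u x) (vector [f\<^sub>1, f\<^sub>2, f\<^sub>3])
      = (oct_fourier u (vector [f\<^sub>1, f\<^sub>2, f\<^sub>3 + f\<^sub>0])
         - oct_fourier u (vector [f\<^sub>1, f\<^sub>2, f\<^sub>3 - f\<^sub>0])) * (oct_e4 /\<^sub>R 2)"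
proof (intro allI conjI)
  fix f\<^sub>1 f\<^sub>2 f\<^sub>3 :: real
  \<comment> \<open>Multiplying out the frequencies brings the phases into the form
    \<open>- (\<alpha> + \<delta>)\<close> and \<open>- (\<alpha> - \<delta>)\<close> in which the pointwise identities rewrite the integrand.\<close>
  note phase_simps = oct_fourier_diff_mult[OF assms] vector_3 distrib_left distrib_right
    left_diff_distrib right_diff_distrib
  show "oct_fourier (\<lambda>x. sin (2 * pi * f\<^sub>0 * x $ 1) *\<^sub>R u x) (vector [f\<^sub>1, f\<^sub>2, f\<^sub>3])
      = (oct_fourier u (vector [f\<^sub>1 + f\<^sub>0, - f\<^sub>2, - f\<^sub>3])
         - oct_fourier u (vector [f\<^sub>1 - f\<^sub>0, - f\<^sub>2, - f\<^sub>3])) * (oct_e1 /\<^sub>R 2)"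
    unfolding phase_simps oct_modulation_two_later_factors[OF oct_units_square(1)
        oct_units_anticommute(1,2)]
    by (simp add: oct_fourier_def oct_scaleR_left)
  show "oct_fourier (\<lambda>x. sin (2 * pi * f\<^sub>0 * x $ 2) *\<^sub>R u x) (vector [f\<^sub>1, f\<^sub>2, f\<^sub>3])
      = (oct_fourier u (vector [f\<^sub>1, f\<^sub>2 + f\<^sub>0, - f\<^sub>3])
         - oct_fourier u (vector [f\<^sub>1, f\<^sub>2 - f\<^sub>0, - f\<^sub>3])) * (oct_e2 /\<^sub>R 2)"
    unfolding phase_simps oct_modulation_one_later_factor[OF oct_units_square(2)
        oct_units_anticommute(3)]
    by (simp add: oct_fourier_def oct_scaleR_left)
  show "oct_fourier (\<lambda>x. sin (2 * pi * f\<^sub>0 * x $ 3) *\<^sub>R u x) (vector [f\<^sub>1, f\<^sub>2, f\<^sub>3])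
      = (oct_fourier u (vector [f\<^sub>1, f\<^sub>2, f\<^sub>3 + f\<^sub>0])
         - oct_fourier u (vector [f\<^sub>1, f\<^sub>2, f\<^sub>3 - f\<^sub>0])) * (oct_e4 /\<^sub>R 2)"
    unfolding phase_simps oct_modulation_last[OF oct_units_square(3)]
    by (simp add: oct_fourier_def oct_scaleR_left)
qed

end
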